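(* Let $m\geq 1$, let $X$ be a topological space, and let $g:X\to D^m$ be a continuous map. Let $i:g^{-1}(S^{m-1})\hookrightarrow X$ be the inclusion map and let $g_|:g^{-1}(S^{m-1})\to S^{m-1}$ be the restriction of $g$. If for some cohomology theory $h^\ast$ and some element $e^{m-1}\neq 0$ of $h^{m-1}(S^{m-1})$ we have \[(g_|)^\ast(e^{m-1})\notin\mathrm{Im}\left(i^\ast:h^\ast(X)\to h^\ast\left(g^{-1}(S^{m-1})\right)\right),\] then $(X,D^m;g)$ has the coincidence property (and $\mathrm{sec}_g(\pi_{2,1}^{D^m})=2$).
   Context: Maps are continuous. $D^m=\{x\in\mathbb{R}^m:\|x\|\leq 1\}$ is the unit disc and $S^{m-1}=\{x\in\mathbb{R}^m:\|x\|=1\}$ its boundary sphere. For a map $g:X\to Y$, the triple $(X,Y;g)$ has the coincidence property (CP) if for every map $f:X\to Y$ there is a point $x\in X$ with $f(x)=g(x)$. $F(Y,2)=\{(y_1,y_2)\in Y^2\mid y_1\neq y_2\}$ with the subspace topology from $Y^2$, and $\pi_{2,1}^Y:F(Y,2)\to Y$ is $\pi_{2,1}^Y(y_1,y_2)=y_1$. The sectional number $\mathrm{sec}(f)$ of a map $f:A\to B$ is the minimal cardinality of open covers of $B$ such that for each element $U$ of the cover there is a map $s:U\to A$ with $f\circ s$ equal to the inclusion $U\hookrightarrow B$ (with value $\infty$ if no finite such cover exists). For maps $p:E\to B$ and $g:X\to B$, the relative sectional number is $\mathrm{sec}_g(p)=\mathrm{sec}(g^\ast(p))$, where $g^\ast(p):X\times_B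 E\to X$, $(x,e)\mapsto x$, and $X\times_B E=\{(x,e)\in X\times E: g(x)=p(e)\}$. *)

theory Defs
  imports "HOL-Analysis.Analysis" "HOL-Algebra.Exact_Sequence" "HOL-Library.Extended_Nat"
begin

section \<open>Coincidence property\<close>

definition coincidence_property :: "'a topology \<Rightarrow> 'b topology \<Rightarrow> ('a \<Rightarrow> 'b) \<Rightarrow> bool"
  where "coincidence_property X Y g \<longleftrightarrow>
    (\<forall>f. continuous_map X Y f \<longrightarrow> (\<exists>x\<in>topspace X. f x = g x))"

section \<open>Relative sectional number\<close>

definition conf2 :: "'b topology \<Rightarrow> ('b \<times> 'b) topology"
  where "conf2 Y = subtopology (prod_topology Y Y) {(y1, y2). y1 \<noteq> y2}"

text \<open>The infimum is taken in \<^typ>\<open>enat\<close>, so it is attained when some finite cover with local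
  sections exists and is \<open>\<infinity>\<close> (the infimum of the empty set) otherwise.\<close>

definition sectional_number :: "'e topology \<Rightarrow> 'b topology \<Rightarrow> ('e \<Rightarrow> 'b) \<Rightarrow> enat"
  where "sectional_number A B f = Inf {enat (card \<U>) | \<U>.
    finite \<U> \<and> \<Union>\<U> = topspace B \<and>
    (\<forall>U\<in>\<U>. openin B U \<and>
      (\<exists>s. continuous_map (subtopology B U) A s \<and> (\<forall>b\<in>U. f (s b) = b)))}"

definition pullback_space ::
    "'a topology \<Rightarrow> 'e topology \<Rightarrow> ('a \<Rightarrow> 'b) \<Rightarrow> ('e \<Rightarrow> 'b) \<Rightarrow> ('a \<times> 'e) topology"
  where "pullback_space X E g p = subtopology (prod_topology X E) {(x, e). g x = p e}"

definition relative_sectional_number ::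
    "'a topology \<Rightarrow> 'e topology \<Rightarrow> ('a \<Rightarrow> 'b) \<Rightarrow> ('e \<Rightarrow> 'b) \<Rightarrow> enat"
  where "relative_sectional_number X E g p = sectional_number (pullback_space X E g p) X fst"

section \<open>Cohomology theories\<close>

definition pair_map ::
    "'u topology \<Rightarrow> 'u set \<Rightarrow> 'u topology \<Rightarrow> 'u set \<Rightarrow> ('u \<Rightarrow> 'u) \<Rightarrow> bool"
  where "pair_map X A Y B f \<longleftrightarrow>
    A \<subseteq> topspace X \<and> B \<subseteq> topspace Y \<and> continuous_map X Y f \<and> f ` A \<subseteq> B"

text \<open>
  The Eilenberg--Steenrod axioms without the dimension axiom, i.e. a generalized cohomology theory
  with values in abelian groups, on all pairs of spaces whose points lie in a type \<open>'u\<close>.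
  \<^item> HOL cannot quantify over the spaces of all types at once, so \<open>'u\<close> plays the role of the
    universe; a cohomology theory on all pairs restricts to every such universe.
  \<^item> \<open>H n X A\<close> is the group \<open>h\<^sup>n(X, A)\<close>, with \<open>A = {}\<close> in the absolute case.
  \<^item> \<open>ind n X A Y B f\<close> is \<open>f\<^sup>* : h\<^sup>n(Y, B) \<rightarrow> h\<^sup>n(X, A)\<close>, and \<open>\<delta> n X A\<close> is the coboundary
    \<open>h\<^sup>n(A) \<rightarrow> h\<^sup>n\<^sup>+\<^sup>1(X, A)\<close>; both are constrained only on the carriers.
  \<^item> Groups are written multiplicatively as in \<^theory>\<open>HOL-Algebra.Group\<close>: the zero class is \<open>\<one>\<close>.
\<close>

locale cohomology_theory =
  fixes H :: "int \<Rightarrow> 'u topology \<Rightarrow> 'u set \<Rightarrow> 'g monoid"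
    and ind :: "int \<Rightarrow> 'u topology \<Rightarrow> 'u set \<Rightarrow> 'u topology \<Rightarrow> 'u set \<Rightarrow> ('u \<Rightarrow> 'u) \<Rightarrow> 'g \<Rightarrow> 'g"
    and \<delta> :: "int \<Rightarrow> 'u topology \<Rightarrow> 'u set \<Rightarrow> 'g \<Rightarrow> 'g"
  assumes comm_group_H: "A \<subseteq> topspace X \<Longrightarrow> comm_group (H n X A)"
    and ind_hom: "pair_map X A Y B f \<Longrightarrow> ind n X A Y B f \<in> hom (H n Y B) (H n X A)"
    and ind_id: "\<lbrakk>A \<subseteq> topspace X; c \<in> carrier (H n X A)\<rbrakk> \<Longrightarrow> ind n X A X A id c = c"
    and ind_compose: "\<lbrakk>pair_map X A Y B f; pair_map Y B Z C k; c \<in> carrier (H n Z C)\<rbrakk>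
      \<Longrightarrow> ind n X A Z C (k \<circ> f) c = ind n X A Y B f (ind n Y B Z C k c)"
    and coboundary_hom: "A \<subseteq> topspace X
      \<Longrightarrow> \<delta> n X A \<in> hom (H n (subtopology X A) {}) (H (n + 1) X A)"
    and coboundary_natural: "\<lbrakk>pair_map X A Y B f; c \<in> carrier (H n (subtopology Y B) {})\<rbrakk>
      \<Longrightarrow> \<delta> n X A (ind n (subtopology X A) {} (subtopology Y B) {} f c)
        = ind (n + 1) X A Y B f (\<delta> n Y B c)"
    and homotopy: "\<lbrakk>pair_map X A Y B f; pair_map X A Y B k;
        homotopic_with (\<lambda>q. q ` A \<subseteq> B) X Y f k; c \<in> carrier (H n Y B)\<rbrakk>
      \<Longrightarrow> ind n X A Y B f c = ind n X A Y B k c"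
    and exactness: "A \<subseteq> topspace X \<Longrightarrow> exact_seq
      ([H (n + 1) X {}, H (n + 1) X A, H n (subtopology X A) {}, H n X {}, H n X A],
       [ind (n + 1) X {} X A id, \<delta> n X A, ind n (subtopology X A) {} X {} id, ind n X {} X A id])"
    and excision: "\<lbrakk>A \<subseteq> topspace X; U \<subseteq> A; X closure_of U \<subseteq> X interior_of A\<rbrakk>
      \<Longrightarrow> ind n (subtopology X (topspace X - U)) (A - U) X A id
        \<in> iso (H n X A) (H n (subtopology X (topspace X - U)) (A - U))"

end

theory Submission
  imports Defs
begin

text \<open>
  If \<open>f\<close> and \<open>g\<close> had no coincidence, the ray from \<open>f x\<close> through \<open>g x\<close> would leave the disc at a point
  \<open>r x\<close> of the sphere depending continuously on \<open>x\<close>, with \<open>r x = g x\<close> whenever \<open>g x\<close> lies on the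
  sphere. So \<open>r\<close> would extend \<open>g\<close> restricted to the preimage of the sphere, and the class pulled back
  from \<open>e\<close> would be the restriction of the pullback of \<open>e\<close> along \<open>r\<close>. A global section of the pullback
  of \<open>\<pi>\<^sub>2\<^sub>,\<^sub>1\<close> is the same as a map without coincidence with \<open>g\<close>, whereas two constant maps give local
  sections over an open cover with two members.
\<close>

text \<open>With \<open>d = b - a\<close>, the coefficient of \<open>d\<close> is the larger root
  \<open>s\<close> of the quadratic \<open>(norm (b + s *\<^sub>R d))\<^sup>2 = 1\<close>, the root
  for the exit beyond \<open>b\<close> when \<open>b\<close> lies in the disc.\<close>

definition ray_exit :: "'v::real_inner \<Rightarrow> 'v \<Rightarrow> 'v" where
  "ray_exit a b = b + ((sqrt ((b \<bullet> (b - a))\<^sup>2 + (norm (b - a))\<^sup>2 * (1 - (norm b)\<^sup>2)) - b \<bullet> (b - a))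
      / (norm (b - a))\<^sup>2) *\<^sub>R (b - a)"

lemma norm_ray_exit:
  assumes "norm b \<le> 1" "a \<noteq> b"
  shows "norm (ray_exit a b) = 1"
proof -
  define d where "d = b - a"
  define N where "N = (norm d)\<^sup>2"
  define D where "D = (b \<bullet> d)\<^sup>2 + N * (1 - (norm b)\<^sup>2)"
  define s where "s = (sqrt D - b \<bullet> d) / N"
  have "N > 0" using assms by (simp add: N_def d_def)
  have "(norm b)\<^sup>2 \<le> 1" using assms(1) by (simp add: power_le_one)
  then have "D \<ge> 0" using \<open>N > 0\<close> by (simp add: D_def)
  have Ns: "N * s = sqrt D - b \<bullet> d" using \<open>N > 0\<close> by (simp add: s_def)
  \<comment> \<open>This is the quadratic for \<open>s\<close> after completing the square;
    expanding it and cancelling \<open>N\<close> recovers the original equation.\<close>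
  have "(N * s + b \<bullet> d)\<^sup>2 = D" using \<open>D \<ge> 0\<close> by (simp add: Ns)
  then have "N * ((norm b)\<^sup>2 + 2 * s * (b \<bullet> d) + s\<^sup>2 * N) = N * 1"
    by (simp add: D_def power2_eq_square algebra_simps)
  then have "(norm b)\<^sup>2 + 2 * s * (b \<bullet> d) + s\<^sup>2 * N = 1" using \<open>N > 0\<close> by simp
  moreover have "(norm (b + s *\<^sub>R d))\<^sup>2 = (norm b)\<^sup>2 + 2 * s * (b \<bullet> d) + s\<^sup>2 * N"
    unfolding N_def power2_norm_eq_inner
    by (simp add: inner_simps inner_commute power2_eq_square algebra_simps)
  ultimately have "(norm (b + s *\<^sub>R d))\<^sup>2 = 1" by simp
  then have "norm (b + s *\<^sub>R d) = 1" using norm_ge_zero[of "b + s *\<^sub>R d"] by (auto simp: power2_eq_1_iff)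
  then show ?thesis by (simp add: ray_exit_def s_def D_def N_def d_def)
qed

text \<open>For \<open>b\<close> on the sphere the discriminant is a square, and Cauchy-Schwarz
  makes its root cancel against \<open>b \<bullet> (b - a)\<close>, so the coefficient
  vanishes.\<close>

lemma ray_exit_sphere:
  assumes "norm a \<le> 1" "norm b = 1"
  shows "ray_exit a b = b"
proof -
  have "b \<bullet> a \<le> norm b * norm a" by (rule norm_cauchy_schwarz)
  moreover have "b \<bullet> b = 1" using assms(2) by (simp add: dot_square_norm)
  ultimately have "b \<bullet> (b - a) \<ge> 0" using assms by (simp add: inner_diff_right)
  then show ?thesis using assms(2) by (simp add: ray_exit_def)
qed

lemma continuous_on_ray_exit:
  "continuous_on {p. fst p \<noteq> snd p} (\<lambda>p. ray_exit (fst p) (snd p))"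
  unfolding ray_exit_def by (intro continuous_intros) auto

lemma coincidence_free_extension:
  fixes g :: "'a \<Rightarrow> 'v::euclidean_space"
  assumes f: "continuous_map X (top_of_set (cball 0 1)) f"
    and g: "continuous_map X (top_of_set (cball 0 1)) g"
    and ne: "\<And>x. x \<in> topspace X \<Longrightarrow> f x \<noteq> g x"
  obtains r where "continuous_map X (top_of_set (sphere 0 1)) r"
    and "\<And>x. x \<in> topspace X \<Longrightarrow> g x \<in> sphere 0 1 \<Longrightarrow> r x = g x"
proof -
  have f1: "norm (f x) \<le> 1" and g1: "norm (g x) \<le> 1" if "x \<in> topspace X" for x
    using f g that by (auto simp: continuous_map_in_subtopology)
  have "continuous_map X euclidean (\<lambda>x. (f x, g x))"
    unfolding prod_topology_euclidean[symmetric]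
    using f g by (intro continuous_map_pairedI) (simp_all add: continuous_map_in_subtopology)
  then have "continuous_map X (top_of_set {p. fst p \<noteq> snd p}) (\<lambda>x. (f x, g x))"
    using ne by (auto simp: continuous_map_in_subtopology)
  moreover have "continuous_map (top_of_set {p. fst p \<noteq> snd p}) euclidean
      (\<lambda>p. ray_exit (fst p) (snd p :: 'v))"
    using continuous_on_ray_exit by simp
  ultimately have "continuous_map X euclidean
      ((\<lambda>p. ray_exit (fst p) (snd p)) \<circ> (\<lambda>x. (f x, g x)))"
    by (rule continuous_map_compose)
  then have "continuous_map X (top_of_set (sphere 0 1)) (\<lambda>x. ray_exit (f x) (g x))"
    using ne g1 by (auto simp: continuous_map_in_subtopology o_def norm_ray_exit)
  then show thesis
    using that[of "\<lambda>x. ray_exit (f x) (g x)"] f1 by (simp add: ray_exit_sphere)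
qed

context cohomology_theory
begin

text \<open>Maps are total functions here, so two of them can differ outside the space and still be
  the same continuous map. The constant homotopy identifies what they induce.\<close>

lemma ind_cong:
  assumes "pair_map X A Y B f" "pair_map X A Y B k" "\<And>x. x \<in> topspace X \<Longrightarrow> f x = k x"
    and "c \<in> carrier (H n Y B)"
  shows "ind n X A Y B f c = ind n X A Y B k c"
proof (rule homotopy[OF assms(1,2) _ assms(4)])
  show "homotopic_with (\<lambda>q. q ` A \<subseteq> B) X Y f k"
  proof (rule homotopic_with_equal)
    show "continuous_map X Y f" "f ` A \<subseteq> B" "k ` A \<subseteq> B"
      using assms(1,2) by (auto simp: pair_map_def)
  qed (use assms(3) in auto)
qed

text \<open>If \<open>r\<close> extends \<open>k\<close>, then \<open>k\<close> is \<open>r\<close>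
  after the inclusion, and functoriality factors the pullback along \<open>k\<close> through the
  restriction from \<open>X\<close>.\<close>

lemma ind_extension_in_range:
  assumes r: "continuous_map X Y r" and k: "continuous_map (subtopology X A) Y k"
    and eq: "\<And>x. x \<in> topspace X \<inter> A \<Longrightarrow> k x = r x"
    and c: "c \<in> carrier (H n Y {})"
  shows "ind n (subtopology X A) {} Y {} k c
    \<in> ind n (subtopology X A) {} X {} id ` carrier (H n X {})"
proof -
  have pr: "pair_map X {} Y {} r" using r by (simp add: pair_map_def)
  have pi: "pair_map (subtopology X A) {} X {} id"
    by (simp add: pair_map_def continuous_map_from_subtopology)
  have "ind n (subtopology X A) {} Y {} k c = ind n (subtopology X A) {} Y {} (r \<circ> id) c"
    using r k eq c
    by (intro ind_cong) (auto simp: pair_map_def continuous_map_from_subtopology)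
  also have "\<dots> = ind n (subtopology X A) {} X {} id (ind n X {} Y {} r c)"
    by (rule ind_compose[OF pi pr c])
  finally show ?thesis
    using hom_in_carrier[OF ind_hom[OF pr] c] by auto
qed

end

lemma continuous_map_pullback_conf2:
  assumes "openin X U" and g: "continuous_map X Y g"
    and c: "continuous_map (subtopology X U) Y c" and ne: "\<And>x. x \<in> U \<Longrightarrow> g x \<noteq> c x"
  shows "continuous_map (subtopology X U) (pullback_space X (conf2 Y) g fst) (\<lambda>x. (x, g x, c x))"
  using assms openin_subset[OF assms(1)]
  by (auto simp: pullback_space_def conf2_def continuous_map_in_subtopology
      continuous_map_from_subtopology intro!: continuous_map_pairedI
      continuous_map_id[unfolded id_def])

text \<open>The last coordinate of a global section is a map that would have to meet
  \<open>g\<close>, which \<open>conf2\<close> forbids.\<close>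

lemma coincidence_property_no_section:
  assumes cp: "coincidence_property X Y g"
    and s: "continuous_map X (pullback_space X (conf2 Y) g fst) s"
    and fst_s: "\<And>x. x \<in> topspace X \<Longrightarrow> fst (s x) = x"
  shows False
proof -
  have s': "continuous_map X (prod_topology X (prod_topology Y Y)) s"
    and s_in: "\<And>x. x \<in> topspace X \<Longrightarrow> g (fst (s x)) = fst (snd (s x)) \<and> fst (snd (s x)) \<noteq> snd (snd (s x))"
    using s by (auto simp: pullback_space_def conf2_def continuous_map_in_subtopology
        prod_topology_subtopology subtopology_subtopology Pi_iff case_prod_unfold)
  have "continuous_map X Y (snd \<circ> (snd \<circ> s))"
    by (intro continuous_map_compose[OF continuous_map_compose[OF s' continuous_map_snd]
          continuous_map_snd])
  then obtain x where "x \<in> topspace X" "(snd \<circ> (snd \<circ> s)) x = g x"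
    using cp unfolding coincidence_property_def by blast
  then show False using s_in[of x] fst_s[of x] by auto
qed

lemma relative_sectional_number_conf2_ge_2:
  assumes cp: "coincidence_property X Y g" and g: "continuous_map X Y g"
  shows "relative_sectional_number X (conf2 Y) g fst \<ge> 2"
  unfolding relative_sectional_number_def sectional_number_def
proof (rule Inf_greatest, clarify)
  fix \<U>
  assume fin: "finite \<U>" and cov: "\<Union>\<U> = topspace X"
    and sec: "\<forall>U\<in>\<U>. openin X U \<and> (\<exists>s. continuous_map (subtopology X U)
      (pullback_space X (conf2 Y) g fst) s \<and> (\<forall>b\<in>U. fst (s b) = b))"
  \<comment> \<open>Over an empty space \<open>g\<close> itself would be a map without a coincidence
    point.\<close>
  have "topspace X \<noteq> {}"
    using cp g by (auto simp: coincidence_property_def)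
  then have "card \<U> \<noteq> 0" using fin cov by (metis Union_empty card_0_eq)
  moreover have "card \<U> \<noteq> 1"
  proof
    assume "card \<U> = 1"
    then have "\<U> = {topspace X}" using cov by (auto simp: card_1_singleton_iff)
    then obtain s where "continuous_map X (pullback_space X (conf2 Y) g fst) s"
      "\<forall>b\<in>topspace X. fst (s b) = b"
      using sec by auto
    then show False using coincidence_property_no_section[OF cp] by blast
  qed
  ultimately have "2 \<le> card \<U>" by linarith
  then show "2 \<le> enat (card \<U>)" by (simp add: numeral_eq_enat)
qed

lemma relative_sectional_number_conf2_le_2:
  assumes g: "continuous_map X Y g" and Y: "t1_space Y"
    and pq: "p \<in> topspace Y" "q \<in> topspace Y" "p \<noteq> q"
  shows "relative_sectional_number X (conf2 Y) g fst \<le> 2"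
proof -
  \<comment> \<open>On \<open>W y\<close> the constant map \<open>y\<close> avoids \<open>g\<close>
    and so yields a local section; \<open>W y\<close> is open because points of \<open>Y\<close> are
    closed.\<close>
  define W where "W y = {x \<in> topspace X. g x \<in> topspace Y - {y}}" for y
  have op: "openin X (W y)" for y
    using Y unfolding W_def
    by (intro openin_continuous_map_preimage[OF g])
      (metis openin_topspace t1_space_openin_delete_alt)
  have sec: "\<exists>s. continuous_map (subtopology X (W y)) (pullback_space X (conf2 Y) g fst) s
      \<and> (\<forall>b\<in>W y. fst (s b) = b)" if "y \<in> topspace Y" for y
  proof (intro exI conjI)
    show "continuous_map (subtopology X (W y)) (pullback_space X (conf2 Y) g fst) (\<lambda>x. (x, g x, y))"
      by (rule continuous_map_pullback_conf2[OF op g]) (use that in \<open>simp_all add: W_def\<close>)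
  qed simp
  have "\<Union>{W p, W q} = topspace X"
    using continuous_map_image_subset_topspace[OF g] pq by (auto simp: W_def)
  then have "sectional_number (pullback_space X (conf2 Y) g fst) X fst \<le> enat (card {W p, W q})"
    unfolding sectional_number_def
    using sec[OF pq(1)] sec[OF pq(2)] op
    by (intro Inf_lower CollectI exI[of _ "{W p, W q}"]) simp
  \<comment> \<open>Only an inequality, since \<open>W p\<close> and \<open>W q\<close> may
    coincide.\<close>
  also have "\<dots> \<le> 2"
    by (simp add: numeral_eq_enat card_insert_if)
  finally show ?thesis by (simp add: relative_sectional_number_def)
qed

theorem proposition3p12:
  fixes X :: "'a topology" and g :: "'a \<Rightarrow> real ^ 'm"
    and H :: "int \<Rightarrow> 'u topology \<Rightarrow> 'u set \<Rightarrow> 'g monoid"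
    and ind :: "int \<Rightarrow> 'u topology \<Rightarrow> 'u set \<Rightarrow> 'u topology \<Rightarrow> 'u set \<Rightarrow> ('u \<Rightarrow> 'u) \<Rightarrow> 'g \<Rightarrow> 'g"
    and \<delta> :: "int \<Rightarrow> 'u topology \<Rightarrow> 'u set \<Rightarrow> 'g \<Rightarrow> 'g"
    and X' S' :: "'u topology"
  assumes "continuous_map X (top_of_set (cball 0 1)) g"
    and "A = {x \<in> topspace X. g x \<in> sphere 0 1}"
    and "cohomology_theory H ind \<delta>"
    (* X' and S' are copies of X and of the sphere inside the universe 'u of the theory, so that
       phi ` A is the copy of A, its inclusion into X' is i, and (sigma o g o phi') is g restricted to A *)
    and "homeomorphic_maps X X' \<phi> \<phi>'"
    and "homeomorphic_maps (top_of_set (sphere (0 :: real ^ 'm) 1)) S' \<sigma> \<sigma>'"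
    and "e \<in> carrier (H (int CARD('m) - 1) S' {})"
    and "e \<noteq> \<one>\<^bsub>H (int CARD('m) - 1) S' {}\<^esub>"
    and "ind (int CARD('m) - 1) (subtopology X' (\<phi> ` A)) {} S' {} (\<sigma> \<circ> g \<circ> \<phi>') e
      \<notin> ind (int CARD('m) - 1) (subtopology X' (\<phi> ` A)) {} X' {} id
          ` carrier (H (int CARD('m) - 1) X' {})"
  shows "coincidence_property X (top_of_set (cball 0 1)) g
    \<and> relative_sectional_number X (conf2 (top_of_set (cball (0 :: real ^ 'm) 1))) g fst = 2"
proof -
  let ?D = "top_of_set (cball (0 :: real ^ 'm) 1)"
  interpret cohomology_theory H ind \<delta> by fact
  have \<phi>: "continuous_map X X' \<phi>" and \<phi>': "continuous_map X' X \<phi>'"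
    and inv: "\<And>x. x \<in> topspace X \<Longrightarrow> \<phi>' (\<phi> x) = x"
    using assms(4) by (auto simp: homeomorphic_maps_def)
  have \<sigma>: "continuous_map (top_of_set (sphere 0 1)) S' \<sigma>"
    using assms(5) by (simp add: homeomorphic_maps_def)
  have cp: "coincidence_property X ?D g"
    unfolding coincidence_property_def
  proof (intro allI impI, rule ccontr)
    fix f assume f: "continuous_map X ?D f" and "\<not> (\<exists>x\<in>topspace X. f x = g x)"
    then obtain r where r: "continuous_map X (top_of_set (sphere 0 1)) r"
      and r_eq: "\<And>x. x \<in> topspace X \<Longrightarrow> g x \<in> sphere 0 1 \<Longrightarrow> r x = g x"
      using coincidence_free_extension[OF f assms(1)] by blast
    have \<sigma>r: "continuous_map X' S' (\<sigma> \<circ> r \<circ> \<phi>')"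
      using continuous_map_compose[OF \<phi>' continuous_map_compose[OF r \<sigma>]] by simp
    have eq: "(\<sigma> \<circ> g \<circ> \<phi>') x = (\<sigma> \<circ> r \<circ> \<phi>') x" if "x \<in> topspace X' \<inter> \<phi> ` A" for x
      using that inv r_eq by (auto simp: assms(2))
    \<comment> \<open>Composing does not give this directly, as \<open>\<sigma>\<close> is
      continuous only on the sphere while \<open>g\<close> maps into the disc. Continuity is
      transferred from the map built with \<open>r\<close>.\<close>
    have "continuous_map (subtopology X' (\<phi> ` A)) S' (\<sigma> \<circ> g \<circ> \<phi>')"
      using continuous_map_from_subtopology[OF \<sigma>r] eq
      by (subst continuous_map_eq[of _ _ "\<sigma> \<circ> r \<circ> \<phi>'"]) auto
    then show False
      using ind_extension_in_range[OF \<sigma>r _ eq assms(6)] assms(8) by blast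
  qed
  \<comment> \<open>The points \<open>0\<close> and \<open>v\<close> serve as the two distinct
    constants for the upper bound.\<close>
  obtain v :: "real ^ 'm" where v: "norm v = 1"
    using vector_choose_size[of 1] by auto
  have "t1_space ?D"
    by (simp add: Hausdorff_imp_t1_space Hausdorff_space_subtopology)
  then have "relative_sectional_number X (conf2 ?D) g fst \<le> 2"
    using v by (intro relative_sectional_number_conf2_le_2[OF assms(1), of 0 v]) auto
  then show ?thesis
    using cp relative_sectional_number_conf2_ge_2[OF cp assms(1)] by (simp add: order.antisym)
qed

end
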